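(* Let $(\mathsf P,\mathcal O)$ be a semitopology, let $\mathsf{Val}$ be a nonempty set equipped with the discrete semitopology $\mathcal P(\mathsf{Val})$, and let $f:\mathsf P\to\mathsf{Val}$ be any function. Let $T\subseteq\mathsf P$ be a transitive set and let $p,p'\in T$. Then: (1) if $f$ is continuous at $p$ and at $p'$, then $f(p)=f(p')$; (2) consequently, if $f$ is continuous at every point of $T$, then $f$ is constant on $T$.
   Context: A semitopology $(\mathsf P,\mathcal O)$ consists of a set $\mathsf P$ of points and a family $\mathcal O\subseteq\mathcal P(\mathsf P)$ of open sets such that $\varnothing,\mathsf P\in\mathcal O$ and $\mathcal O$ is closed under arbitrary unions; intersections of open sets need not be open. For sets $X,Y$ write $X\between Y$ when $X\cap Y\neq\varnothing$. A set $T\subseteq\mathsf P$ is transitive when for all $O,O'\in\mathcal O$, if $O\between T$ and $T\between O'$ then $O\between O'$. A function $f:\mathsf P\to\mathsf P'$ between semitopologies is continuous at $p$ when for every open $O'\ni f(p)$ there is an open $O\ni p$ with $O\subseteq f^{-1}(O')$. *)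

theory Defs
  imports "HOL-Library.FuncSet"
begin

definition semitopology :: "'a set \<Rightarrow> 'a set set \<Rightarrow> bool" where
  "semitopology P Opens \<longleftrightarrow>
     Opens \<subseteq> Pow P \<and> {} \<in> Opens \<and> P \<in> Opens \<and> (\<forall>\<X>. \<X> \<subseteq> Opens \<longrightarrow> \<Union>\<X> \<in> Opens)"

definition meets :: "'a set \<Rightarrow> 'a set \<Rightarrow> bool" (infix "\<between>" 50) where
  "X \<between> Y \<longleftrightarrow> X \<inter> Y \<noteq> {}"

definition transitive_set :: "'a set \<Rightarrow> 'a set set \<Rightarrow> 'a set \<Rightarrow> bool" where
  "transitive_set P Opens T \<longleftrightarrow>
     T \<subseteq> P \<and> (\<forall>U\<in>Opens. \<forall>U'\<in>Opens. U \<between> T \<and> T \<between> U' \<longrightarrow> U \<between> U')"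

text \<open>A function between carriers is a total function of which only the values on \<open>P\<close> matter,
  so the preimage of \<open>U'\<close> is \<open>f -` U' \<inter> P\<close>.\<close>

definition continuous_at_point ::
  "'a set \<Rightarrow> 'a set set \<Rightarrow> 'b set set \<Rightarrow> ('a \<Rightarrow> 'b) \<Rightarrow> 'a \<Rightarrow> bool" where
  "continuous_at_point P Opens Opens' f p \<longleftrightarrow>
     (\<forall>U'\<in>Opens'. f p \<in> U' \<longrightarrow> (\<exists>U\<in>Opens. p \<in> U \<and> U \<subseteq> f -` U' \<inter> P))"

lemma semitopology_discrete: "semitopology V (Pow V)"
  by (auto simp: semitopology_def)

end

theory Submission
  imports Defs
begin

text \<open>In a discrete codomain singletons are open, so continuity at \<open>p\<close> makes
  \<open>f\<close> constant on some open neighbourhood of \<open>p\<close>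
  (\<open>continuous_at_point_discreteE\<close>). If \<open>p\<close> and \<open>p'\<close> lie in
  \<open>T\<close>, their two neighbourhoods both meet \<open>T\<close>, and transitivity forces
  them to meet each other. At a common point \<open>f\<close> takes both values, so these agree
  (\<open>transitive_set_continuous_eq\<close>). Constancy on \<open>T\<close> follows by comparing
  every point with a fixed one.\<close>

lemma continuous_at_point_discreteE:
  assumes "continuous_at_point P Opens (Pow V) f p" and "f p \<in> V"
  obtains U where "U \<in> Opens" "p \<in> U" "\<And>x. x \<in> U \<Longrightarrow> f x = f p"
proof -
  \<comment> \<open>The smallest open set around \<open>f p\<close>: its preimage is the fibre of
    \<open>f\<close> through \<open>p\<close>.\<close>
  have "{f p} \<in> Pow V"
    using assms(2) by simp
  then obtain U where "U \<in> Opens" "p \<in> U" "U \<subseteq> f -` {f p} \<inter> P"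
    using assms(1) unfolding continuous_at_point_def by blast
  then show thesis
    by (intro that[of U]) auto
qed

lemma transitive_set_continuous_eq:
  assumes "transitive_set P Opens T" and "f \<in> P \<rightarrow> V"
    and "p \<in> T" "continuous_at_point P Opens (Pow V) f p"
    and "p' \<in> T" "continuous_at_point P Opens (Pow V) f p'"
  shows "f p = f p'"
proof -
  have "f p \<in> V" "f p' \<in> V"
    using assms by (auto simp: transitive_set_def)
  obtain U where U: "U \<in> Opens" "p \<in> U" "\<And>x. x \<in> U \<Longrightarrow> f x = f p"
    using continuous_at_point_discreteE[OF assms(4) \<open>f p \<in> V\<close>] by blast
  obtain U' where U': "U' \<in> Opens" "p' \<in> U'" "\<And>x. x \<in> U' \<Longrightarrow> f x = f p'"
    using continuous_at_point_discreteE[OF assms(6) \<open>f p' \<in> V\<close>] by blast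
  have "U \<between> T" "T \<between> U'"
    using U(2) U'(2) assms(3,5) by (auto simp: meets_def)
  then have "U \<between> U'"
    using assms(1) U(1) U'(1) by (simp add: transitive_set_def)
  \<comment> \<open>The point \<open>x\<close> may lie outside \<open>T\<close>; this is harmless
    because \<open>f\<close> is constant on all of \<open>U\<close> and of
    \<open>U'\<close>.\<close>
  then obtain x where "x \<in> U" "x \<in> U'"
    by (auto simp: meets_def)
  then show ?thesis
    using U(3) U'(3) by metis
qed

theorem theorem3p5:
  fixes P :: "'a set" and Opens :: "'a set set" and Val :: "'b set"
    and f :: "'a \<Rightarrow> 'b" and T :: "'a set"
  assumes "semitopology P Opens"
    and "Val \<noteq> {}"
    and "f \<in> P \<rightarrow> Val"
    and "transitive_set P Opens T"
  shows "(\<forall>p\<in>T. \<forall>p'\<in>T.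
            continuous_at_point P Opens (Pow Val) f p \<and>
            continuous_at_point P Opens (Pow Val) f p' \<longrightarrow> f p = f p') \<and>
         ((\<forall>p\<in>T. continuous_at_point P Opens (Pow Val) f p) \<longrightarrow>
            (\<exists>v\<in>Val. \<forall>p\<in>T. f p = v))"
proof (intro conjI ballI impI)
  fix p p'
  assume "p \<in> T" "p' \<in> T"
    and "continuous_at_point P Opens (Pow Val) f p \<and> continuous_at_point P Opens (Pow Val) f p'"
  then show "f p = f p'"
    using transitive_set_continuous_eq[OF assms(4,3)] by blast
next
  assume cont: "\<forall>p\<in>T. continuous_at_point P Opens (Pow Val) f p"
  show "\<exists>v\<in>Val. \<forall>p\<in>T. f p = v"
  \<comment> \<open>Constancy is phrased as the existence of a value in \<open>Val\<close>; for
    empty \<open>T\<close> any element of the nonempty \<open>Val\<close> serves, otherwise the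
    value at some \<open>q\<close> in \<open>T\<close>.\<close>
  proof (cases "T = {}")
    case True
    then show ?thesis
      using assms(2) by blast
  next
    case False
    then obtain q where "q \<in> T"
      by blast
    moreover have "f q \<in> Val"
      using \<open>q \<in> T\<close> assms(3,4) by (auto simp: transitive_set_def)
    ultimately show ?thesis
      using cont transitive_set_continuous_eq[OF assms(4,3)] by blast
  qed
qed

end
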